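(* Let $L>0$, $T>0$, $W^0\in\widehat H^0(\mathbb R^2)$, $W^T\in\widehat H^0(\mathbb R^2)$, and put $W_0^T=W^T-\mathcal W_0(\cdot,T)$. Suppose that $W_0^T\in\mathcal H$ and that $$|W_0^T(x)|\le\frac L{2\pi}e^{-\frac{|x|^2}{4T}}\ln\left(1+\frac{4T}{|x|^2}\right),\quad x\in\mathbb R^2\setminus\{0\}.$$ Let $$\omega_n=-2\frac{n!}{(2n)!}\int_0^\infty\int_0^\infty x_1^{2n}W_0^T(x_1,x_2)\,dx_1\,dx_2,\quad n\in\mathbb N_0=\{0,1,2,\dots\}.$$ Then $W^T\in\mathcal R_T^L(W^0)$ if and only if there exists $u\in L^\infty(0,T)$ with $\|u\|_{L^\infty(0,T)}\le L$ such that $$\int_0^T\xi^nu(T-\xi)\,d\xi=\omega_n\quad\text{for all }n\in\mathbb N_0.$$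
   Context: $\mathbb R_+=(0,+\infty)$; function spaces are complex; pointwise bounds on $L^2$ functions are understood a.e. $\widehat H^0(\mathbb R^2)$ is the subspace of $L^2(\mathbb R^2)$ of functions even with respect to $x_1$. $\mathcal H=\{f\in L^2(\mathbb R^2): \exists g\in L^2(\mathbb R_+),\ f(x)=g(|x|^2)\text{ a.e. on }\mathbb R^2\}$. For $W^0\in\widehat H^0(\mathbb R^2)$ and $u\in L^\infty(0,T)$ put $$\mathcal W_0(\cdot,T)=\frac1{4\pi T}e^{-\frac{|\cdot|^2}{4T}}*W^0,\qquad \mathcal W_u(x,T)=-\frac1\pi\int_0^T\frac1{2\xi}e^{-\frac{|x|^2}{4\xi}}u(T-\xi)\,d\xi .$$ Then $W(\cdot,T)=\mathcal W_0(\cdot,T)+\mathcal W_u(\cdot,T)$ is the state at time $T$ of the unique solution of the control system $W_t=\Delta W-2\delta u(t)$, $W(\cdot,0)=W^0$ on $\mathbb R^2$. Let $$\mathcal R_T^L(W^0)=\{V\in\widehat H^0(\mathbb R^2):\exists u\in L^\infty(0,T),\ \|u\|_{L^\infty(0,T)}\le L,\ V=\mathcal W_0(\cdot,T)+\mathcal W_u(\cdot,T)\}.$$ *)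

theory Defs
  imports "HOL-Analysis.Analysis" "HOL-Probability.Essential_Supremum"
begin

text \<open>
  Elements of the \<open>L\<^sup>p\<close> spaces are represented by Borel measurable functions, and identities
  between them hold almost everywhere. The plane is \<open>real \<times> real\<close>, whose norm is the Euclidean one.
\<close>

definition L2 :: "'a measure \<Rightarrow> ('a \<Rightarrow> complex) set" where
  "L2 M = {f \<in> borel_measurable M. integrable M (\<lambda>x. (cmod (f x))\<^sup>2)}"

definition Linf_norm :: "'a measure \<Rightarrow> ('a \<Rightarrow> complex) \<Rightarrow> ereal" where
  "Linf_norm M u = esssup M (\<lambda>x. ereal (cmod (u x)))"

definition Linf :: "'a measure \<Rightarrow> ('a \<Rightarrow> complex) set" where
  "Linf M = {u \<in> borel_measurable M. Linf_norm M u < \<infinity>}"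

abbreviation lborel_on :: "real set \<Rightarrow> real measure" where
  "lborel_on S \<equiv> restrict_space lborel S"

definition H0_hat :: "(real \<times> real \<Rightarrow> complex) set" where
  "H0_hat = {f \<in> L2 lborel. AE x in lborel. f (- fst x, snd x) = f x}"

definition H_rad :: "(real \<times> real \<Rightarrow> complex) set" where
  "H_rad = {f \<in> L2 lborel.
     \<exists>g \<in> L2 (lborel_on {0<..}). AE x in lborel. f x = g ((norm x)\<^sup>2)}"

definition convolution_fun ::
  "(real \<times> real \<Rightarrow> complex) \<Rightarrow> (real \<times> real \<Rightarrow> complex) \<Rightarrow> real \<times> real \<Rightarrow> complex" where
  "convolution_fun k f x = (LINT y|lborel. k (x - y) * f y)"

definition heat_kernel :: "real \<Rightarrow> real \<times> real \<Rightarrow> complex" where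
  "heat_kernel T x = complex_of_real (1 / (4 * pi * T) * exp (- (norm x)\<^sup>2 / (4 * T)))"

definition free_state :: "(real \<times> real \<Rightarrow> complex) \<Rightarrow> real \<Rightarrow> real \<times> real \<Rightarrow> complex" where
  "free_state W0 T = convolution_fun (heat_kernel T) W0"

text \<open>At \<open>x = 0\<close> the integrand below need not be integrable (the Bochner integral is then \<open>0\<close>);
  this affects a null set only.\<close>

definition control_state :: "(real \<Rightarrow> complex) \<Rightarrow> real \<Rightarrow> real \<times> real \<Rightarrow> complex" where
  "control_state u T x = - complex_of_real (1 / pi) *
     (LINT \<xi>:{0<..<T}|lborel.
        complex_of_real (1 / (2 * \<xi>) * exp (- (norm x)\<^sup>2 / (4 * \<xi>))) * u (T - \<xi>))"

definition reachable ::
  "real \<Rightarrow> real \<Rightarrow> (real \<times> real \<Rightarrow> complex) \<Rightarrow> (real \<times> real \<Rightarrow> complex) set" where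
  "reachable T L W0 = {V \<in> H0_hat.
     \<exists>u \<in> Linf (lborel_on {0<..<T}). Linf_norm (lborel_on {0<..<T}) u \<le> ereal L \<and>
       (AE x in lborel. V x = free_state W0 T x + control_state u T x)}"

end

theory Submission
  imports Defs "HOL-Probability.Levy" "HOL-Probability.Distributions"
begin

text \<open>
  Both \<open>W\<^sub>0\<^sup>T\<close> and the controlled part of the state are radial, that is, functions of \<open>s = |x|\<^sup>2\<close>.
  The map \<open>x \<mapsto> |x|\<^sup>2\<close> sends the measure \<open>x\<^sub>1\<^bsup>2n\<^esup> dx\<close> on the quadrant to a multiple of \<open>s\<^sup>n ds\<close>
  on the half line, so the numbers \<open>\<omega> n\<close> are, up to constants, the power moments of the profile of
  \<open>W\<^sub>0\<^sup>T\<close>. By Fubini's theorem the same constants turn the moments of the profile of the controlled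
  part into the moments of \<open>\<xi> \<mapsto> u (T - \<xi>)\<close>. Both profiles decay exponentially (for \<open>W\<^sub>0\<^sup>T\<close> this is
  the assumed pointwise bound), and an exponentially decaying function on the half line is determined
  by its moments.
\<close>

subsection \<open>Radial functions on the quadrant\<close>

text \<open>Substituting \<open>s = a * y\<^sup>2\<close> is done on the compact intervals
  \<open>{0..real N}\<close> and extended to the half line by monotone convergence. The endpoint 0
  is a null set.\<close>

lemma nn_integral_substitution_scaled_square:
  fixes G :: "real \<Rightarrow> ennreal"
  assumes [measurable]: "G \<in> borel_measurable borel" and a: "0 < a"
  shows "(\<integral>\<^sup>+s. G s * indicator {0<..} s \<partial>lborel) =
    (\<integral>\<^sup>+y. G (a * y\<^sup>2) * ennreal (2 * a * y) * indicator {0<..} y \<partial>lborel)"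
proof -
  have eq: "(\<integral>\<^sup>+s. G s * indicator {0..a * (real N)\<^sup>2} s \<partial>lborel) =
      (\<integral>\<^sup>+y. G (a * y\<^sup>2) * ennreal (2 * a * y) * indicator {0..real N} y \<partial>lborel)" (is "?l N = ?r N") for N :: nat
  \<comment> \<open>The substitution rule asks for a nondegenerate interval. For
    \<open>N = 0\<close> both integrals run over a single point.\<close>
  proof (cases "N = 0")
    case True
    have "AE s in lborel. G s * indicator {0} s = G (a * s\<^sup>2) * ennreal (2 * a * s) * indicator {0} s"
      using AE_lborel_singleton[of "0::real"] by eventually_elim simp
    with True show ?thesis
      by (intro nn_integral_cong_AE) simp
  next
    case False
    have "(\<integral>\<^sup>+s. G s * indicator {a * 0\<^sup>2..a * (real N)\<^sup>2} s \<partial>lborel) =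
        (\<integral>\<^sup>+y. G (a * y\<^sup>2) * ennreal (2 * a * y) * indicator {0..real N} y \<partial>lborel)"
      using False a
      by (intro nn_integral_substitution_aux)
         (auto intro!: derivative_eq_intros continuous_intros)
    then show ?thesis by simp
  qed
  have ev': "eventually (\<lambda>N. y \<le> real N) sequentially" for y :: real
    using eventually_ge_at_top[of "nat \<lceil>y\<rceil>"] by eventually_elim linarith
  have ev: "eventually (\<lambda>N. y \<le> a * (real N)\<^sup>2) sequentially" for y :: real
    using ev'[of "y / a"]
  proof eventually_elim
    case (elim N)
    \<comment> \<open>A natural number is at most its square, so the threshold \<open>y / a\<close>
      for \<open>real N\<close> also works for its square.\<close>
    have "real N \<le> (real N)\<^sup>2"
      by (cases N) (auto simp: power2_eq_square)
    with elim have "y / a \<le> (real N)\<^sup>2"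
      by linarith
    with a show ?case
      by (simp add: field_simps)
  qed
  have "?l \<longlonglongrightarrow> (\<integral>\<^sup>+s. G s * indicator {0..} s \<partial>lborel)"
  proof (rule nn_integral_LIMSEQ)
    show "incseq (\<lambda>N s. G s * indicator {0..a * (real N)\<^sup>2} s)"
      using a by (auto simp: incseq_def le_fun_def split: split_indicator
          intro: order_trans mult_left_mono power_mono)
    show "(\<lambda>N. G s * indicator {0..a * (real N)\<^sup>2} s) \<longlonglongrightarrow> G s * indicator {0..} s" for s
      by (rule tendsto_eventually, rule eventually_mono[OF ev[of s]]) (auto split: split_indicator)
  qed auto
  moreover have "?r \<longlonglongrightarrow> (\<integral>\<^sup>+y. G (a * y\<^sup>2) * ennreal (2 * a * y) * indicator {0..} y \<partial>lborel)"
  proof (rule nn_integral_LIMSEQ)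
    show "incseq (\<lambda>N y. G (a * y\<^sup>2) * ennreal (2 * a * y) * indicator {0..real N} y)"
      by (auto simp: incseq_def le_fun_def split: split_indicator)
    show "(\<lambda>N. G (a * y\<^sup>2) * ennreal (2 * a * y) * indicator {0..real N} y) \<longlonglongrightarrow>
        G (a * y\<^sup>2) * ennreal (2 * a * y) * indicator {0..} y" for y
      by (rule tendsto_eventually, rule eventually_mono[OF ev'[of y]]) (auto split: split_indicator)
  qed auto
  ultimately have "(\<integral>\<^sup>+s. G s * indicator {0..} s \<partial>lborel) =
      (\<integral>\<^sup>+y. G (a * y\<^sup>2) * ennreal (2 * a * y) * indicator {0..} y \<partial>lborel)"
    unfolding eq by (rule LIMSEQ_unique)
  moreover have "AE s in lborel. (s::real) \<noteq> 0"
    by (rule AE_lborel_singleton)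
  then have "(\<integral>\<^sup>+s. G s * indicator {0<..} s \<partial>lborel) = (\<integral>\<^sup>+s. G s * indicator {0..} s \<partial>lborel)"
    by (intro nn_integral_cong_AE) (auto split: split_indicator)
  moreover have "(\<integral>\<^sup>+y. G (a * y\<^sup>2) * ennreal (2 * a * y) * indicator {0<..} y \<partial>lborel) =
      (\<integral>\<^sup>+y. G (a * y\<^sup>2) * ennreal (2 * a * y) * indicator {0..} y \<partial>lborel)"
    by (intro nn_integral_cong) (auto split: split_indicator)
  ultimately show ?thesis by simp
qed

abbreviation quadrant :: "(real \<times> real) set" where
  "quadrant \<equiv> {0<..} \<times> {0<..}"

text \<open>In the coordinates \<open>x = y * t\<close> one has
  \<open>x\<^sup>2 + y\<^sup>2 = y\<^sup>2 * (1 + t\<^sup>2)\<close>. After exchanging the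
  integrals, the substitution \<open>s = (1 + t\<^sup>2) * y\<^sup>2\<close> at fixed
  \<open>t\<close> splits the integral into a factor depending only on \<open>n\<close> and a
  one-dimensional integral of \<open>F\<close>. This replaces polar coordinates.\<close>

lemma nn_integral_quadrant_radial_aux:
  fixes F :: "real \<Rightarrow> ennreal"
  assumes [measurable]: "F \<in> borel_measurable borel"
  shows "(\<integral>\<^sup>+x. ennreal (fst x ^ (2 * n)) * F ((norm x)\<^sup>2) * indicator quadrant x \<partial>lborel) =
    (\<integral>\<^sup>+t. ennreal (t ^ (2 * n) / (2 * (1 + t\<^sup>2) ^ Suc n)) * indicator {0<..} t \<partial>lborel) *
    (\<integral>\<^sup>+s. ennreal (s ^ n) * F s * indicator {0<..} s \<partial>lborel)"
proof -
  interpret lborel_pair: pair_sigma_finite "lborel :: real measure" "lborel :: real measure" ..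
  let ?I = "\<integral>\<^sup>+s. ennreal (s ^ n) * F s * indicator {0<..} s \<partial>lborel"
  have [measurable]: "quadrant \<in> sets (borel \<Otimes>\<^sub>M borel)"
    by (intro pair_measureI) auto
  have "(\<integral>\<^sup>+x. ennreal (fst x ^ (2 * n)) * F ((norm x)\<^sup>2) * indicator quadrant x \<partial>lborel) =
      (\<integral>\<^sup>+x. ennreal (fst x ^ (2 * n)) * F ((fst x)\<^sup>2 + (snd x)\<^sup>2) * indicator quadrant x
        \<partial>(lborel \<Otimes>\<^sub>M lborel))"
    by (simp add: lborel_prod norm_prod_def)
  also have "\<dots> = (\<integral>\<^sup>+y. \<integral>\<^sup>+x. ennreal (x ^ (2 * n)) * F (x\<^sup>2 + y\<^sup>2) *
      indicator quadrant (x, y) \<partial>lborel \<partial>lborel)"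
    by (subst lborel_pair.nn_integral_snd[symmetric]) auto
  also have "\<dots> = (\<integral>\<^sup>+y. \<integral>\<^sup>+t. ennreal (y * (y * t) ^ (2 * n)) * F (y\<^sup>2 * (1 + t\<^sup>2)) *
      indicator quadrant (t, y) \<partial>lborel \<partial>lborel)"
  proof (rule nn_integral_cong)
    fix y :: real
    show "(\<integral>\<^sup>+x. ennreal (x ^ (2 * n)) * F (x\<^sup>2 + y\<^sup>2) * indicator quadrant (x, y) \<partial>lborel) =
      (\<integral>\<^sup>+t. ennreal (y * (y * t) ^ (2 * n)) * F (y\<^sup>2 * (1 + t\<^sup>2)) * indicator quadrant (t, y) \<partial>lborel)"
    proof (cases "0 < y")
      case True
      \<comment> \<open>The linear change \<open>x = y * t\<close> has Jacobian \<open>y\<close> and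
        preserves the positive half line because \<open>y\<close> is positive.\<close>
      have "(\<integral>\<^sup>+x. ennreal (x ^ (2 * n)) * F (x\<^sup>2 + y\<^sup>2) * indicator quadrant (x, y) \<partial>lborel) =
        ennreal \<bar>y\<bar> * (\<integral>\<^sup>+t. ennreal ((0 + y * t) ^ (2 * n)) * F ((0 + y * t)\<^sup>2 + y\<^sup>2) *
           indicator quadrant (0 + y * t, y) \<partial>lborel)"
        using True by (subst nn_integral_real_affine[where c=y and t=0]) auto
      also have "\<dots> = (\<integral>\<^sup>+t. ennreal \<bar>y\<bar> * (ennreal ((0 + y * t) ^ (2 * n)) * F ((0 + y * t)\<^sup>2 + y\<^sup>2) *
           indicator quadrant (0 + y * t, y)) \<partial>lborel)"
        by (rule nn_integral_cmult[symmetric]) auto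
      also have "\<dots> = (\<integral>\<^sup>+t. ennreal (y * (y * t) ^ (2 * n)) * F (y\<^sup>2 * (1 + t\<^sup>2)) * indicator quadrant (t, y) \<partial>lborel)"
        using True
        by (intro nn_integral_cong)
           (auto simp: zero_less_mult_iff algebra_simps power_mult_distrib ennreal_mult split: split_indicator)
      finally show ?thesis .
    qed (simp add: indicator_times)
  qed
  also have "\<dots> = (\<integral>\<^sup>+t. \<integral>\<^sup>+y. ennreal (y * (y * t) ^ (2 * n)) * F (y\<^sup>2 * (1 + t\<^sup>2)) *
      indicator quadrant (t, y) \<partial>lborel \<partial>lborel)"
    by (rule lborel_pair.Fubini') simp
  also have "\<dots> = (\<integral>\<^sup>+t. (ennreal (t ^ (2 * n) / (2 * (1 + t\<^sup>2) ^ Suc n)) * indicator {0<..} t) * ?I \<partial>lborel)"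
  proof (intro nn_integral_cong)
    fix t :: real
    define a where "a = 1 + t\<^sup>2"
    have a: "a > 0" unfolding a_def by (simp add: add_pos_nonneg)
    \<comment> \<open>This \<open>c\<close> is what remains of \<open>y * (y * t) ^ (2 * n)\<close>
      once \<open>s ^ n\<close> with \<open>s = a * y\<^sup>2\<close> and the Jacobian
      \<open>2 * a * y\<close> are split off.\<close>
    define c where "c = t ^ (2 * n) / (2 * a ^ Suc n)"
    have c: "c \<ge> 0" using a by (simp add: c_def)
    have "(\<integral>\<^sup>+y. ennreal (y * (y * t) ^ (2 * n)) * F (y\<^sup>2 * a) * indicator {0<..} y \<partial>lborel) =
        (\<integral>\<^sup>+y. (ennreal (c * (a * y\<^sup>2) ^ n) * F (a * y\<^sup>2)) * ennreal (2 * a * y) * indicator {0<..} y \<partial>lborel)"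
    proof (intro nn_integral_cong)
      fix y :: real
      have "y * (y * t) ^ (2 * n) = c * (a * y\<^sup>2) ^ n * (2 * a * y)"
        using a by (simp add: c_def field_simps power_mult_distrib flip: power_mult)
      moreover have "ennreal (c * (a * y\<^sup>2) ^ n * (2 * a * y)) =
          ennreal (c * (a * y\<^sup>2) ^ n) * ennreal (2 * a * y)" if "y > 0"
        using that a c by (intro ennreal_mult mult_nonneg_nonneg) auto
      ultimately have "ennreal (y * (y * t) ^ (2 * n)) =
          ennreal (c * (a * y\<^sup>2) ^ n) * ennreal (2 * a * y)" if "y > 0"
        using that by (simp only:)
      then show "ennreal (y * (y * t) ^ (2 * n)) * F (y\<^sup>2 * a) * indicator {0<..} y =
          (ennreal (c * (a * y\<^sup>2) ^ n) * F (a * y\<^sup>2)) * ennreal (2 * a * y) * indicator {0<..} y"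
        by (auto simp: ac_simps split: split_indicator)
    qed
    also have "\<dots> = (\<integral>\<^sup>+s. (ennreal (c * s ^ n) * F s) * indicator {0<..} s \<partial>lborel)"
      using a by (intro nn_integral_substitution_scaled_square[symmetric]) auto
    also have "\<dots> = (\<integral>\<^sup>+s. ennreal c * (ennreal (s ^ n) * F s * indicator {0<..} s) \<partial>lborel)"
      using c by (intro nn_integral_cong) (auto simp: ennreal_mult ac_simps split: split_indicator)
    also have "\<dots> = ennreal c * ?I"
      by (rule nn_integral_cmult) auto
    finally show "(\<integral>\<^sup>+y. ennreal (y * (y * t) ^ (2 * n)) * F (y\<^sup>2 * (1 + t\<^sup>2)) *
      indicator quadrant (t, y) \<partial>lborel) =
      (ennreal (t ^ (2 * n) / (2 * (1 + t\<^sup>2) ^ Suc n)) * indicator {0<..} t) * ?I"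
      by (cases "t > 0") (auto simp: a_def c_def indicator_times)
  qed
  also have "\<dots> = (\<integral>\<^sup>+t. ennreal (t ^ (2 * n) / (2 * (1 + t\<^sup>2) ^ Suc n)) * indicator {0<..} t \<partial>lborel) * ?I"
    by (rule nn_integral_multc) auto
  finally show ?thesis .
qed

text \<open>This is B(n + 1/2, 1/2) / 4 with Euler's Beta function, the closed form of the integral
  over \<open>t\<close> in the preceding factorization.\<close>

definition radial_const :: "nat \<Rightarrow> real" where
  "radial_const n = pi * fact (2 * n) / (4 ^ Suc n * (fact n)\<^sup>2)"

lemma radial_const_pos: "radial_const n > 0"
  by (simp add: radial_const_def)

lemma nn_integral_exp_Ioi:
  "(\<integral>\<^sup>+s. ennreal (s ^ n) * ennreal (exp (- s)) * indicator {0<..} s \<partial>lborel) = ennreal (fact n)"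
proof -
  have "AE s in lborel. (s::real) \<noteq> 0"
    by (rule AE_lborel_singleton)
  then have "(\<integral>\<^sup>+s. ennreal (s ^ n) * ennreal (exp (- s)) * indicator {0<..} s \<partial>lborel) =
      (\<integral>\<^sup>+s. ennreal (s ^ n * exp (- s)) * indicator {0..} s \<partial>lborel)"
    by (intro nn_integral_cong_AE) (auto simp: ennreal_mult split: split_indicator)
  then show ?thesis
    by (simp add: nn_intergal_power_times_exp_Ici)
qed

lemma nn_integral_gaussian_moment_Ioi:
  "(\<integral>\<^sup>+x. ennreal (x ^ (2 * n) * exp (- x\<^sup>2)) * indicator {0<..} x \<partial>lborel) =
    ennreal (sqrt pi / 2 * (fact (2 * n) / (2 ^ (2 * n) * fact n)))"
proof -
  have "AE x in lborel. (x::real) \<noteq> 0"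
    by (rule AE_lborel_singleton)
  then have "(\<integral>\<^sup>+x. ennreal (x ^ (2 * n) * exp (- x\<^sup>2)) * indicator {0<..} x \<partial>lborel) =
      (\<integral>\<^sup>+x. ennreal (indicator {0..} x *\<^sub>R (exp (- x\<^sup>2) * x ^ (2 * n))) \<partial>lborel)"
    by (intro nn_integral_cong_AE) (auto simp: ac_simps split: split_indicator)
  also have "\<dots> = ennreal (sqrt pi / 2 * (fact (2 * n) / (2 ^ (2 * n) * fact n)))"
    using gaussian_moment_even_pos[of n]
    by (subst nn_integral_eq_integral) (auto simp: has_bochner_integral_iff)
  finally show ?thesis .
qed

text \<open>The constant is determined by testing with the Gaussian.\<close>

lemma nn_integral_quadrant_radial:
  fixes F :: "real \<Rightarrow> ennreal"
  assumes F[measurable]: "F \<in> borel_measurable borel"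
  shows "(\<integral>\<^sup>+x. ennreal (fst x ^ (2 * n)) * F ((norm x)\<^sup>2) * indicator quadrant x \<partial>lborel) =
    ennreal (radial_const n) * (\<integral>\<^sup>+s. ennreal (s ^ n) * F s * indicator {0<..} s \<partial>lborel)"
proof -
  interpret lborel_pair: pair_sigma_finite "lborel :: real measure" "lborel :: real measure" ..
  let ?C = "\<integral>\<^sup>+t. ennreal (t ^ (2 * n) / (2 * (1 + t\<^sup>2) ^ Suc n)) * indicator {0<..} t \<partial>lborel"
  let ?m = "\<lambda>n. sqrt pi / 2 * (fact (2 * n) / (2 ^ (2 * n) * fact n)) :: real"
  have [measurable]: "quadrant \<in> sets (borel \<Otimes>\<^sub>M borel)"
    by (intro pair_measureI) auto
  \<comment> \<open>For the test function exp(-s) the radial factor is \<open>fact n\<close>, and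
    the integral over the quadrant separates into two one-dimensional Gaussian moments.\<close>
  have "?C * ennreal (fact n) =
      (\<integral>\<^sup>+x. ennreal (fst x ^ (2 * n)) * ennreal (exp (- (norm x)\<^sup>2)) * indicator quadrant x \<partial>lborel)"
    by (subst nn_integral_quadrant_radial_aux) (auto simp: nn_integral_exp_Ioi)
  also have "\<dots> = (\<integral>\<^sup>+x. ennreal (fst x ^ (2 * n)) * ennreal (exp (- ((fst x)\<^sup>2 + (snd x)\<^sup>2))) * indicator quadrant x
        \<partial>(lborel \<Otimes>\<^sub>M lborel))"
    by (simp add: lborel_prod norm_prod_def)
  also have "\<dots> = (\<integral>\<^sup>+y. \<integral>\<^sup>+x. ennreal (x ^ (2 * n)) * ennreal (exp (- (x\<^sup>2 + y\<^sup>2))) * indicator quadrant (x, y) \<partial>lborel \<partial>lborel)"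
    by (subst lborel_pair.nn_integral_snd[symmetric]) auto
  also have "\<dots> = (\<integral>\<^sup>+y. \<integral>\<^sup>+x. (ennreal (y ^ (2 * 0) * exp (- y\<^sup>2)) * indicator {0<..} y) *
      (ennreal (x ^ (2 * n) * exp (- x\<^sup>2)) * indicator {0<..} x) \<partial>lborel \<partial>lborel)"
    by (intro nn_integral_cong)
       (auto simp: exp_add exp_diff exp_minus field_simps simp flip: ennreal_mult split: split_indicator)
  also have "\<dots> = ennreal (?m 0) * ennreal (?m n)"
    unfolding nn_integral_gaussian_moment_Ioi[symmetric]
    by (subst nn_integral_cmult) (auto simp: nn_integral_multc)
  also have "\<dots> = ennreal (?m 0 * ?m n)"
    by (rule ennreal_mult[symmetric]) auto
  finally have C: "?C * ennreal (fact n) = ennreal (?m 0 * ?m n)" .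
  \<comment> \<open>Solving for \<open>?C\<close> by multiplying with the reciprocal avoids having
    to know first that \<open>?C\<close> is finite.\<close>
  have "?C = ?C * ennreal (fact n) * ennreal (1 / fact n)"
    by (simp add: mult.assoc flip: ennreal_mult)
  also have "\<dots> = ennreal (?m 0 * ?m n * (1 / fact n))"
    unfolding C by (rule ennreal_mult[symmetric]) auto
  also have "?m 0 * ?m n * (1 / fact n) = radial_const n"
    by (simp add: radial_const_def field_simps power2_eq_square power_mult flip: power_mult_distrib)
  finally show ?thesis
    unfolding nn_integral_quadrant_radial_aux[OF F] by simp
qed

lemma fst_borel_measurable [measurable]: "(fst :: real \<times> real \<Rightarrow> real) \<in> borel_measurable borel"
  by (intro borel_measurable_continuous_onI continuous_intros)

lemma quadrant_borel [measurable]: "quadrant \<in> sets borel"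
  by (simp add: borel_prod[symmetric] pair_measureI)

text \<open>This is the preceding formula for indicator functions. Phrased as an equality of
  measures, it transports null sets as well as integrals of complex functions.\<close>

lemma distr_quadrant_norm_squared:
  "distr (density lborel (\<lambda>x. ennreal (fst x ^ (2 * n) * indicator quadrant x))) borel (\<lambda>x. (norm x)\<^sup>2) =
    density lborel (\<lambda>s. ennreal (radial_const n * s ^ n * indicator {0<..} s))"
    (is "?M = ?N")
proof (rule measure_eqI)
  fix A :: "real set" assume "A \<in> sets ?M"
  then have [measurable]: "A \<in> sets borel" by simp
  have "emeasure ?M A = (\<integral>\<^sup>+s. indicator A s \<partial>?M)"
    by simp
  also have "\<dots> = (\<integral>\<^sup>+x. ennreal (fst x ^ (2 * n) * indicator quadrant x) * indicator A ((norm x)\<^sup>2) \<partial>lborel)"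
    by (subst nn_integral_distr) (auto simp: nn_integral_density)
  also have "\<dots> = (\<integral>\<^sup>+x. ennreal (fst x ^ (2 * n)) * indicator A ((norm x)\<^sup>2) * indicator quadrant x \<partial>lborel)"
    by (intro nn_integral_cong) (auto split: split_indicator)
  also have "\<dots> = ennreal (radial_const n) * (\<integral>\<^sup>+s. ennreal (s ^ n) * indicator A s * indicator {0<..} s \<partial>lborel)"
    by (rule nn_integral_quadrant_radial) auto
  also have "\<dots> = (\<integral>\<^sup>+s. ennreal (radial_const n) * (ennreal (s ^ n) * indicator A s * indicator {0<..} s) \<partial>lborel)"
    by (rule nn_integral_cmult[symmetric]) auto
  also have "\<dots> = (\<integral>\<^sup>+s. ennreal (radial_const n * s ^ n * indicator {0<..} s) * indicator A s \<partial>lborel)"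
    using radial_const_pos[of n] by (intro nn_integral_cong) (auto simp: ennreal_mult split: split_indicator)
  also have "\<dots> = emeasure ?N A"
    by (rule emeasure_density[symmetric]) auto
  finally show "emeasure ?M A = emeasure ?N A" .
qed simp

section \<open>Null sets and moments of radial functions\<close>

lemma AE_lborel_uminus:
  assumes "AE x in lborel. P (x :: real)"
  shows "AE x in lborel. P (- x)"
proof (rule AE_distrD[of uminus lborel borel P])
  show "AE x in distr lborel borel uminus. P x"
    using assms by (simp only: lborel_distr_uminus)
qed simp

lemma AE_lborel_even:
  assumes "AE x in lborel. 0 < x \<longrightarrow> P x" and even: "\<And>x :: real. P (- x) \<longleftrightarrow> P x"
  shows "AE x in lborel. P x"
  using assms(1) AE_lborel_uminus[OF assms(1)] AE_lborel_singleton[of 0]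
  by eventually_elim (use even in \<open>force simp: not_less\<close>)

text \<open>The image measure for \<open>n = 0\<close> has a positive constant density on the half
  line, which settles the claim on the quadrant. Reflection in the two axes extends it to the plane,
  since \<open>P ((norm x)\<^sup>2)\<close> is even in each coordinate.\<close>

lemma AE_radial_iff:
  assumes [measurable]: "Measurable.pred borel P"
  shows "(AE x in lborel. P ((norm (x :: real \<times> real))\<^sup>2)) \<longleftrightarrow> (AE s in lborel. 0 < s \<longrightarrow> P s)"
proof -
  interpret lborel_pair: pair_sigma_finite "lborel :: real measure" "lborel :: real measure" ..
  have "(AE s in lborel. 0 < s \<longrightarrow> P s) \<longleftrightarrow>
      (AE s in density lborel (\<lambda>s. ennreal (radial_const 0 * s ^ 0 * indicator {0<..} s)). P s)"
    using radial_const_pos[of 0]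
    by (subst AE_density) (auto intro!: AE_cong split: split_indicator)
  also have "\<dots> \<longleftrightarrow> (AE x in density lborel (\<lambda>x. ennreal (fst x ^ (2 * 0) * indicator quadrant x)). P ((norm x)\<^sup>2))"
    unfolding distr_quadrant_norm_squared[symmetric] by (rule AE_distr_iff) auto
  also have "\<dots> \<longleftrightarrow> (AE x in lborel. x \<in> quadrant \<longrightarrow> P ((norm x)\<^sup>2))"
    by (subst AE_density) (auto intro!: AE_cong split: split_indicator)
  also have "\<dots> \<longleftrightarrow> (AE x in lborel. P ((norm (x :: real \<times> real))\<^sup>2))"
  proof
    assume "AE x in lborel. x \<in> quadrant \<longrightarrow> P ((norm x)\<^sup>2)"
    \<comment> \<open>The property is sliced into an iterated one, so that evenness can be used
      first in the second and then in the first coordinate.\<close>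
    then have "AE x in lborel \<Otimes>\<^sub>M lborel. x \<in> quadrant \<longrightarrow> P ((norm x)\<^sup>2)"
      by (simp only: lborel_prod)
    then have "AE x in lborel. AE y in lborel. (x, y) \<in> quadrant \<longrightarrow> P ((norm (x, y))\<^sup>2)"
      by (rule lborel_pair.AE_pair)
    then have "AE x in lborel. 0 < x \<longrightarrow> (AE y in lborel. P ((norm (x :: real, y :: real))\<^sup>2))"
    proof (rule eventually_mono)
      fix x assume *: "AE y in lborel. (x, y) \<in> quadrant \<longrightarrow> P ((norm (x, y))\<^sup>2)"
      show "0 < x \<longrightarrow> (AE y in lborel. P ((norm (x :: real, y :: real))\<^sup>2))"
      proof
        assume "0 < x"
        with * have "AE y in lborel. 0 < y \<longrightarrow> P ((norm (x, y :: real))\<^sup>2)"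
          by simp
        then show "AE y in lborel. P ((norm (x, y :: real))\<^sup>2)"
          by (rule AE_lborel_even) (simp add: norm_prod_def)
      qed
    qed
    then have "AE x in lborel. AE y in lborel. P ((norm (x :: real, y :: real))\<^sup>2)"
      by (rule AE_lborel_even) (simp add: norm_prod_def)
    \<comment> \<open>Measurability of the set allows the return from iterated almost everywhere to
      the product measure.\<close>
    moreover have "Measurable.pred (borel \<Otimes>\<^sub>M borel) (\<lambda>x :: real \<times> real. P ((fst x)\<^sup>2 + (snd x)\<^sup>2))"
      by measurable
    then have "{x \<in> space (lborel \<Otimes>\<^sub>M lborel). P ((norm (x :: real \<times> real))\<^sup>2)} \<in> sets (lborel \<Otimes>\<^sub>M lborel)"
      by (simp add: pred_def norm_prod_def space_pair_measure)
    ultimately have "AE x in lborel \<Otimes>\<^sub>M lborel. P ((norm (x :: real \<times> real))\<^sup>2)"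
      by (rule lborel_pair.AE_pair_measure[rotated])
    then show "AE x in lborel. P ((norm (x :: real \<times> real))\<^sup>2)"
      by (simp only: lborel_prod)
  qed auto
  finally show ?thesis ..
qed

text \<open>The weighted quadrant integral is an integral against the image measure of the squared
  norm. Integrability is carried along from the line to the quadrant, where it justifies replacing
  the iterated integral by one over the product.\<close>

lemma quadrant_moment_radial:
  fixes W :: "real \<times> real \<Rightarrow> complex" and F :: "real \<Rightarrow> complex"
  assumes [measurable]: "W \<in> borel_measurable borel" "F \<in> borel_measurable borel"
    and supp: "\<And>s. s \<le> 0 \<Longrightarrow> F s = 0"
    and int: "integrable lborel (\<lambda>s. s ^ n *\<^sub>R F s)"
    and W: "AE x in lborel. W x = F ((norm x)\<^sup>2)"
  shows "(LINT x2:{0<..}|lborel. (LINT x1:{0<..}|lborel. complex_of_real (x1 ^ (2 * n)) * W (x1, x2))) =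
    complex_of_real (radial_const n) * (LINT s|lborel. s ^ n *\<^sub>R F s)"
proof -
  interpret lborel_pair: pair_sigma_finite "lborel :: real measure" "lborel :: real measure" ..
  let ?h = "\<lambda>x. fst x ^ (2 * n) * indicator quadrant x"
  let ?d = "\<lambda>s. radial_const n * s ^ n * indicator {0<..} s"
  \<comment> \<open>The indicator in \<open>?d\<close> disappears because \<open>F\<close> vanishes
    on the nonpositive half line.\<close>
  have d: "?d s *\<^sub>R F s = radial_const n *\<^sub>R (s ^ n *\<^sub>R F s)" for s
    using supp[of s] by (auto split: split_indicator)
  have h_nn: "AE x in lborel. 0 \<le> ?h x"
    by (auto split: split_indicator)
  have d_nn: "AE s in lborel. 0 \<le> ?d s"
    using radial_const_pos[of n] by (auto split: split_indicator)
  have W': "AE x in lborel. ?h x *\<^sub>R W x = ?h x *\<^sub>R F ((norm x)\<^sup>2)"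
    using W by eventually_elim simp
  have "integrable (density lborel (\<lambda>s. ennreal (?d s))) F"
    using int d_nn by (subst integrable_density) (simp_all only: d integrable_scaleR_right, auto)
  then have "integrable (density lborel (\<lambda>x. ennreal (?h x))) (\<lambda>x. F ((norm x)\<^sup>2))"
    unfolding distr_quadrant_norm_squared[symmetric] by (subst (asm) integrable_distr_eq) auto
  then have "integrable lborel (\<lambda>x. ?h x *\<^sub>R F ((norm x)\<^sup>2))"
    using h_nn by (subst (asm) integrable_density) auto
  then have intW: "integrable lborel (\<lambda>x. ?h x *\<^sub>R W x)"
    using W' by (subst integrable_cong_AE) auto
  have "(LINT x2:{0<..}|lborel. (LINT x1:{0<..}|lborel. complex_of_real (x1 ^ (2 * n)) * W (x1, x2))) =
      (LINT x2|lborel. LINT x1|lborel. ?h (x1, x2) *\<^sub>R W (x1, x2))"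
    unfolding set_lebesgue_integral_def integral_scaleR_right[symmetric]
    by (intro Bochner_Integration.integral_cong refl)
       (auto simp: indicator_times scaleR_conv_of_real)
  also have "\<dots> = (LINT x|(lborel \<Otimes>\<^sub>M lborel). ?h x *\<^sub>R W x)"
    using lborel_pair.integral_snd[of "\<lambda>x1 x2. ?h (x1, x2) *\<^sub>R W (x1, x2)"] intW
    by (simp add: lborel_prod split_beta')
  also have "\<dots> = (LINT x|lborel. ?h x *\<^sub>R F ((norm x)\<^sup>2))"
    unfolding lborel_prod using W' by (intro integral_cong_AE) auto
  also have "\<dots> = (LINT x|density lborel (\<lambda>x. ennreal (?h x)). F ((norm x)\<^sup>2))"
    using h_nn by (subst integral_density) auto
  also have "\<dots> = (LINT s|density lborel (\<lambda>s. ennreal (?d s)). F s)"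
    unfolding distr_quadrant_norm_squared[symmetric] by (subst integral_distr) auto
  also have "\<dots> = (LINT s|lborel. ?d s *\<^sub>R F s)"
    using d_nn by (subst integral_density) auto
  also have "\<dots> = complex_of_real (radial_const n) * (LINT s|lborel. s ^ n *\<^sub>R F s)"
    unfolding d by (simp add: scaleR_conv_of_real)
  finally show ?thesis .
qed

subsection \<open>Determinacy of the moment problem\<close>

text \<open>A single term of the exponential series with nonnegative terms is at most its
  sum.\<close>

lemma power_le_fact_mult_exp:
  fixes s \<delta> :: real
  assumes "0 < \<delta>" "0 \<le> s"
  shows "s ^ n \<le> fact n / \<delta> ^ n * exp (\<delta> * s)"
proof -
  have "(\<Sum>k\<in>{n}. inverse (fact k) * (\<delta> * s) ^ k) \<le> exp (\<delta> * s)"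
    unfolding exp_def real_scaleR_def using summable_exp[of "\<delta> * s"] assms
    by (intro sum_le_suminf) auto
  then show ?thesis
    using assms by (simp add: field_simps power_mult_distrib)
qed

text \<open>The surplus rate \<open>\<epsilon> - a\<close> absorbs the power of \<open>s\<close>.
  The case \<open>a = 0\<close> gives all moments, and \<open>a = \<bar>t\<bar>\<close> gives the
  dominating function for the power series of the character.\<close>

lemma integrable_power_mult_exp_weighted:
  fixes q :: "real \<Rightarrow> complex"
  assumes [measurable]: "q \<in> borel_measurable borel"
    and supp: "\<And>s. s \<le> 0 \<Longrightarrow> q s = 0"
    and int: "integrable lborel (\<lambda>s. exp (\<epsilon> * s) *\<^sub>R q s)" and a: "a < \<epsilon>"
  shows "integrable lborel (\<lambda>s. (s ^ n * exp (a * s)) *\<^sub>R q s)"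
proof -
  define C where "C = fact n / (\<epsilon> - a) ^ n"
  have C: "C \<ge> 0" using a by (simp add: C_def)
  have bnd: "norm ((s ^ n * exp (a * s)) *\<^sub>R q s) \<le> norm (C *\<^sub>R (exp (\<epsilon> * s) *\<^sub>R q s))" for s
  proof (cases "0 < s")
    case True
    have "s ^ n * exp (a * s) \<le> C * exp ((\<epsilon> - a) * s) * exp (a * s)"
      unfolding C_def using True a by (intro mult_right_mono power_le_fact_mult_exp) auto
    also have "\<dots> = C * exp (\<epsilon> * s)"
      by (simp add: algebra_simps flip: exp_add)
    finally have "s ^ n * exp (a * s) * norm (q s) \<le> C * exp (\<epsilon> * s) * norm (q s)"
      by (rule mult_right_mono) simp
    with True C show ?thesis by (simp add: abs_mult)
  qed (simp add: supp)
  show ?thesis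
    by (rule Bochner_Integration.integrable_bound[OF integrable_scaleR_right[OF int, of C]])
       (use bnd in auto)
qed

text \<open>Expanding the exponential shows that multiplication by \<open>exp (i t s)\<close> with small \<open>t\<close>
  preserves vanishing moments. Iterating reaches all real \<open>t\<close>, although the power series itself
  need not converge under the integral beyond \<open>\<epsilon>\<close>.\<close>

lemma vanishing_moments_iexp_step:
  fixes q :: "real \<Rightarrow> complex"
  assumes q[measurable]: "q \<in> borel_measurable borel"
    and supp: "\<And>s. s \<le> 0 \<Longrightarrow> q s = 0"
    and int: "integrable lborel (\<lambda>s. exp (\<epsilon> * s) *\<^sub>R q s)"
    and t: "\<bar>t\<bar> < \<epsilon>"
    and mom: "\<And>n. (LINT s|lborel. s ^ n *\<^sub>R q s) = 0"
  shows "(LINT s|lborel. s ^ n *\<^sub>R (iexp (t * s) * q s)) = 0"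
proof -
  have \<epsilon>: "0 < \<epsilon>" using t by simp
  have intm: "integrable lborel (\<lambda>s. s ^ k *\<^sub>R q s)" for k
    using integrable_power_mult_exp_weighted[OF q supp int \<epsilon>, of k] by simp
  \<comment> \<open>\<open>S M s\<close> is \<open>s ^ n *\<^sub>R q s\<close> times a partial sum
    of the series of \<open>iexp (t * s)\<close>. Its terms are multiples of moment integrands of
    order \<open>n + m\<close>, so its integral is zero.\<close>
  define S where "S M s = (\<Sum>m<M. ((\<i> * t) ^ m / fact m) * (s ^ (n + m) *\<^sub>R q s))" for M s
  have S_eq: "S M s = (\<Sum>m<M. (\<i> * of_real (t * s)) ^ m /\<^sub>R fact m) * (s ^ n *\<^sub>R q s)" for M s
    unfolding S_def sum_distrib_right
    by (intro sum.cong refl) (simp add: scaleR_conv_of_real field_simps power_mult_distrib power_add)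
  have S0: "(LINT s|lborel. S M s) = 0" for M
    unfolding S_def
    by (subst Bochner_Integration.integral_sum)
       (simp_all only: intm mom integrable_mult_right integral_mult_right_zero mult_zero_right sum.neutral_const)
  have "(\<lambda>M. LINT s|lborel. S M s) \<longlonglongrightarrow> (LINT s|lborel. s ^ n *\<^sub>R (iexp (t * s) * q s))"
  proof (rule integral_dominated_convergence)
    \<comment> \<open>All partial sums of the series are bounded by
      \<open>exp (\<bar>t\<bar> * s)\<close> on the support of \<open>q\<close>, and here
      \<open>\<bar>t\<bar> < \<epsilon>\<close> makes the product integrable.\<close>
    show "integrable lborel (\<lambda>s. norm ((s ^ n * exp (\<bar>t\<bar> * s)) *\<^sub>R q s))"
      using integrable_power_mult_exp_weighted[OF q supp int t, of n] by (rule integrable_norm)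
    show "AE s in lborel. (\<lambda>M. S M s) \<longlonglongrightarrow> s ^ n *\<^sub>R (iexp (t * s) * q s)"
    proof (rule AE_I2)
      fix s
      have "(\<lambda>M. (\<Sum>m<M. (\<i> * of_real (t * s)) ^ m /\<^sub>R fact m) * (s ^ n *\<^sub>R q s))
          \<longlonglongrightarrow> iexp (t * s) * (s ^ n *\<^sub>R q s)"
        using exp_converges[of "\<i> * of_real (t * s)"] by (intro tendsto_intros) (simp add: sums_def)
      then show "(\<lambda>M. S M s) \<longlonglongrightarrow> s ^ n *\<^sub>R (iexp (t * s) * q s)"
        by (simp add: S_eq)
    qed
    fix M
    show "AE s in lborel. norm (S M s) \<le> norm ((s ^ n * exp (\<bar>t\<bar> * s)) *\<^sub>R q s)"
    proof (rule AE_I2)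
      fix s :: real
      show "norm (S M s) \<le> norm ((s ^ n * exp (\<bar>t\<bar> * s)) *\<^sub>R q s)"
      proof (cases "0 < s")
        case True
        have "norm (\<Sum>m<M. (\<i> * of_real (t * s)) ^ m /\<^sub>R fact m) \<le>
            (\<Sum>m<M. norm ((\<i> * complex_of_real (t * s)) ^ m /\<^sub>R fact m))"
          by (rule norm_sum)
        also have "\<dots> = (\<Sum>m<M. (\<bar>t\<bar> * s) ^ m /\<^sub>R fact m)"
          using True by (simp add: norm_mult norm_power abs_mult)
        also have "\<dots> \<le> exp (\<bar>t\<bar> * s)"
          unfolding exp_def using summable_exp[of "\<bar>t\<bar> * s"] True
          by (intro sum_le_suminf) auto
        finally have "norm (\<Sum>m<M. (\<i> * of_real (t * s)) ^ m /\<^sub>R fact m) * norm (s ^ n *\<^sub>R q s) \<le>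
            exp (\<bar>t\<bar> * s) * norm (s ^ n *\<^sub>R q s)"
          by (rule mult_right_mono) simp
        then show ?thesis
          by (simp add: S_eq norm_mult abs_mult mult_ac)
      qed (simp add: S_eq supp)
    qed
  qed (auto simp: S_def)
  then show ?thesis
    unfolding S0 by (simp add: LIMSEQ_const_iff)
qed

text \<open>The frequency \<open>t\<close> is reached in \<open>N\<close> steps of size below
  \<open>\<epsilon>\<close>. A character has modulus 1, so every step starts from a function with
  the same support and the same weighted integrability.\<close>

lemma vanishing_moments_iexp:
  fixes q :: "real \<Rightarrow> complex"
  assumes q[measurable]: "q \<in> borel_measurable borel"
    and supp: "\<And>s. s \<le> 0 \<Longrightarrow> q s = 0"
    and int: "integrable lborel (\<lambda>s. exp (\<epsilon> * s) *\<^sub>R q s)" and \<epsilon>: "0 < \<epsilon>"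
    and mom: "\<And>n. (LINT s|lborel. s ^ n *\<^sub>R q s) = 0"
  shows "(LINT s|lborel. iexp (t * s) * q s) = 0"
proof -
  obtain N :: nat where N: "\<bar>t\<bar> / \<epsilon> < real N"
    using reals_Archimedean2 by blast
  have Npos: "0 < real N"
    using N \<epsilon> by (meson abs_ge_zero divide_nonneg_pos le_less_trans)
  define \<tau> where "\<tau> = t / real N"
  have \<tau>: "\<bar>\<tau>\<bar> < \<epsilon>"
    using N Npos \<epsilon> by (simp add: \<tau>_def abs_divide field_simps)
  have *: "\<forall>n. (LINT s|lborel. s ^ n *\<^sub>R (iexp (real k * \<tau> * s) * q s)) = 0" for k :: nat
  proof (induction k)
    case 0
    then show ?case using mom by simp
  next
    case (Suc k)
    let ?r = "\<lambda>s. iexp (real k * \<tau> * s) * q s"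
    have "integrable lborel (\<lambda>s. exp (\<epsilon> * s) *\<^sub>R ?r s)"
      by (rule Bochner_Integration.integrable_bound[OF int]) (auto simp: norm_mult)
    then have "(LINT s|lborel. s ^ n *\<^sub>R (iexp (\<tau> * s) * ?r s)) = 0" for n
      using Suc \<tau> by (intro vanishing_moments_iexp_step[of ?r]) (auto simp: supp)
    moreover have "iexp (\<tau> * s) * ?r s = iexp (real (Suc k) * \<tau> * s) * q s" for s
      by (simp add: algebra_simps exp_add)
    ultimately show ?case
      by (simp only: simp_thms)
  qed
  have "real N * \<tau> = t"
    using Npos by (simp add: \<tau>_def)
  \<comment> \<open>The induction carries all moments along; only the one of order 0 is wanted in
    the end.\<close>
  with *[of N] show ?thesis
    by (auto dest: spec[of _ 0])
qed

text \<open>The positive and negative parts have equal Fourier transforms, hence equal mass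
  \<open>c\<close>. Divided by \<open>c\<close> they are densities of two probability distributions
  with the same characteristic function, and these coincide by Levy's uniqueness theorem.\<close>

lemma AE_zero_of_vanishing_fourier:
  fixes q :: "real \<Rightarrow> real"
  assumes int: "integrable lborel q"
    and four: "\<And>t. (LINT s|lborel. iexp (t * s) * complex_of_real (q s)) = 0"
  shows "AE s in lborel. q s = 0"
proof -
  have [measurable]: "q \<in> borel_measurable lborel"
    using int by auto
  define p where "p s = max (q s) 0" for s
  define m where "m s = max (- q s) 0" for s
  have q_eq: "q s = p s - m s" for s
    by (simp add: p_def m_def max_def)
  have nn: "p s \<ge> 0" "m s \<ge> 0" for s
    by (simp_all add: p_def m_def)
  have [measurable]: "p \<in> borel_measurable lborel" "m \<in> borel_measurable lborel"
    unfolding p_def[abs_def] m_def[abs_def] by measurable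
  have ip: "integrable lborel p" and im: "integrable lborel m"
    unfolding p_def[abs_def] m_def[abs_def] using int by (auto intro!: integrable_max)
  have icp: "integrable lborel (\<lambda>s. iexp (t * s) * complex_of_real (p s))" for t
    by (rule Bochner_Integration.integrable_bound[OF ip]) (auto simp: norm_mult)
  have icm: "integrable lborel (\<lambda>s. iexp (t * s) * complex_of_real (m s))" for t
    by (rule Bochner_Integration.integrable_bound[OF im]) (auto simp: norm_mult)
  have eq: "(LINT s|lborel. iexp (t * s) * complex_of_real (p s)) =
      (LINT s|lborel. iexp (t * s) * complex_of_real (m s))" for t
    using four[of t] Bochner_Integration.integral_diff[OF icp icm, of t t]
    by (simp add: q_eq algebra_simps)
  define c where "c = integral\<^sup>L lborel p"
  have c_m: "c = integral\<^sup>L lborel m"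
    using eq[of 0] by (simp add: c_def)
  show ?thesis
  \<comment> \<open>Normalization needs positive mass. If \<open>c = 0\<close>, both parts are
    nonnegative with integral zero and vanish almost everywhere.\<close>
  proof (cases "c = 0")
    case True
    then have "AE s in lborel. p s = 0" "AE s in lborel. m s = 0"
      using integral_nonneg_eq_0_iff_AE[OF ip] integral_nonneg_eq_0_iff_AE[OF im] nn c_def c_m
      by auto
    then show ?thesis
      by eventually_elim (simp add: q_eq)
  next
    case False
    moreover have "c \<ge> 0"
      unfolding c_def by (rule integral_nonneg_AE) (simp add: nn)
    ultimately have c: "c > 0"
      by simp
    let ?D = "\<lambda>r. density lborel (\<lambda>s. ennreal (r s / c))"
    have distr: "real_distribution (?D r)" if [measurable]: "r \<in> borel_measurable lborel"
      and "integrable lborel r" "\<And>s. r s \<ge> 0" "integral\<^sup>L lborel r = c" for r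
    proof -
      have "emeasure (?D r) (space (?D r)) = (\<integral>\<^sup>+s. ennreal (r s / c) \<partial>lborel)"
        by (simp add: emeasure_density)
      also have "\<dots> = ennreal (LINT s|lborel. r s / c)"
        using that c by (intro nn_integral_eq_integral) auto
      also have "\<dots> = 1"
        using that c by simp
      finally have "prob_space (?D r)"
        by (rule prob_spaceI)
      then show ?thesis
        by (simp add: real_distribution_def real_distribution_axioms_def)
    qed
    have char: "char (?D r) t = (LINT s|lborel. iexp (t * s) * complex_of_real (r s)) / c"
      if [measurable]: "r \<in> borel_measurable lborel" and "\<And>s. r s \<ge> 0" for r t
      unfolding char_def using that c
      by (subst integral_density) (auto simp: scaleR_conv_of_real mult_ac simp flip: integral_divide_zero)
    have "?D p = ?D m"
    proof (rule Levy_uniqueness)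
      show "real_distribution (?D p)" "real_distribution (?D m)"
        by (intro distr ip im nn c_def[symmetric] c_m[symmetric]; measurable)+
      show "char (?D p) = char (?D m)"
        using eq by (intro ext) (simp add: char nn)
    qed
    then have "AE s in lborel. ennreal (p s / c) = ennreal (m s / c)"
      by (subst (asm) sigma_finite_measure.density_unique_iff[OF sigma_finite_lborel]) auto
    then show ?thesis
      by eventually_elim (use nn c in \<open>simp add: q_eq\<close>)
  qed
qed

text \<open>The Fourier criterion is for real functions, so it is applied to the real and imaginary
  parts. Each is bounded by the modulus of \<open>q\<close>, which passes on the support and the
  weighted integrability, and its moments are the corresponding parts of the moments of
  \<open>q\<close>.\<close>

lemma AE_zero_of_vanishing_moments:
  fixes q :: "real \<Rightarrow> complex"
  assumes q[measurable]: "q \<in> borel_measurable borel"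
    and supp: "\<And>s. s \<le> 0 \<Longrightarrow> q s = 0"
    and int: "integrable lborel (\<lambda>s. exp (\<epsilon> * s) *\<^sub>R q s)" and \<epsilon>: "0 < \<epsilon>"
    and mom: "\<And>n. (LINT s|lborel. s ^ n *\<^sub>R q s) = 0"
  shows "AE s in lborel. q s = 0"
proof -
  have intm: "integrable lborel (\<lambda>s. s ^ k *\<^sub>R q s)" for k
    using integrable_power_mult_exp_weighted[OF q supp int \<epsilon>, of k] by simp
  have part: "AE s in lborel. r s = 0"
    if [measurable]: "r \<in> borel_measurable borel" and le: "\<And>s. \<bar>r s\<bar> \<le> cmod (q s)"
      and r: "\<And>n. (LINT s|lborel. s ^ n * r s) = 0" for r :: "real \<Rightarrow> real"
  proof (rule AE_zero_of_vanishing_fourier)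
    show "integrable lborel r"
      by (rule Bochner_Integration.integrable_bound[OF intm[of 0]]) (use le in auto)
    have "integrable lborel (\<lambda>s. exp (\<epsilon> * s) *\<^sub>R complex_of_real (r s))"
      by (rule Bochner_Integration.integrable_bound[OF int]) (use le in auto)
    moreover have "r s = 0" if "s \<le> 0" for s
      using le[of s] supp[OF that] by simp
    moreover have "(LINT s|lborel. s ^ n *\<^sub>R complex_of_real (r s)) = 0" for n
    proof -
      have "(LINT s|lborel. s ^ n *\<^sub>R complex_of_real (r s)) = (LINT s|lborel. complex_of_real (s ^ n * r s))"
        by (simp add: scaleR_conv_of_real)
      then show ?thesis
        by (simp only: integral_complex_of_real r of_real_0)
    qed
    ultimately show "(LINT s|lborel. iexp (t * s) * complex_of_real (r s)) = 0" for t
      using \<epsilon> by (intro vanishing_moments_iexp) auto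
  qed
  have "AE s in lborel. Re (q s) = 0"
  proof (rule part)
    show "(LINT s|lborel. s ^ n * Re (q s)) = 0" for n
      using integral_Re[OF intm[of n]] mom[of n] by simp
  qed (auto simp: abs_Re_le_cmod)
  moreover have "AE s in lborel. Im (q s) = 0"
  proof (rule part)
    show "(LINT s|lborel. s ^ n * Im (q s)) = 0" for n
      using integral_Im[OF intm[of n]] mom[of n] by simp
  qed (auto simp: abs_Im_le_cmod)
  ultimately show ?thesis
    by eventually_elim (simp add: complex_eq_iff)
qed

subsection \<open>The profile of the controlled state\<close>

lemma nn_integral_power_mult_exp_Ioi:
  assumes a: "0 < a"
  shows "(\<integral>\<^sup>+s. ennreal (s ^ n * exp (- a * s) * indicator {0<..} s) \<partial>lborel) = ennreal (fact n / a ^ Suc n)"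
proof -
  have "(\<integral>\<^sup>+s. ennreal (s ^ n * exp (- a * s) * indicator {0<..} s) \<partial>lborel) =
      \<bar>1 / a\<bar> * (\<integral>\<^sup>+s. ennreal ((0 + 1 / a * s) ^ n * exp (- a * (0 + 1 / a * s)) * indicator {0<..} (0 + 1 / a * s)) \<partial>lborel)"
    using a by (intro nn_integral_real_affine) auto
  also have "(\<integral>\<^sup>+s. ennreal ((0 + 1 / a * s) ^ n * exp (- a * (0 + 1 / a * s)) * indicator {0<..} (0 + 1 / a * s)) \<partial>lborel) =
      (\<integral>\<^sup>+s. ennreal (1 / a ^ n) * (ennreal (s ^ n) * ennreal (exp (- s)) * indicator {0<..} s) \<partial>lborel)"
    using a by (intro nn_integral_cong)
      (auto simp: power_divide zero_less_divide_iff simp flip: ennreal_mult split: split_indicator)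
  also have "\<dots> = ennreal (1 / a ^ n) * ennreal (fact n)"
    by (subst nn_integral_cmult) (auto simp: nn_integral_exp_Ioi)
  finally show ?thesis
    using a by (simp flip: ennreal_mult)
qed

lemma has_bochner_integral_power_mult_exp_Ioi:
  fixes a :: real
  assumes a: "0 < a"
  shows "has_bochner_integral lborel (\<lambda>s. s ^ n * exp (- a * s) * indicator {0<..} s) (fact n / a ^ Suc n)"
  using a by (intro has_bochner_integral_nn_integral nn_integral_power_mult_exp_Ioi)
    (auto split: split_indicator)

text \<open>The variable \<open>s\<close> stands for the squared norm of the point. The two
  indicators turn the kernel into a nonnegative measurable function on the whole plane, ready for
  Fubini on \<open>lborel\<close>.\<close>

definition control_kernel :: "real \<Rightarrow> real \<Rightarrow> real \<Rightarrow> real" where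
  "control_kernel T s \<xi> = indicator {0<..} s * indicator {0<..<T} \<xi> * (1 / (2 * \<xi>) * exp (- s / (4 * \<xi>)))"

text \<open>Here \<open>v\<close> plays the role of the reflected control \<xi> -> u(T - \<xi>),
  extended by zero.\<close>

definition control_profile :: "real \<Rightarrow> (real \<Rightarrow> complex) \<Rightarrow> real \<Rightarrow> complex" where
  "control_profile T v s = - complex_of_real (1 / pi) * (LINT \<xi>|lborel. control_kernel T s \<xi> *\<^sub>R v \<xi>)"

lemma measurable_control_kernel[measurable]:
  assumes [measurable]: "f \<in> borel_measurable M" "g \<in> borel_measurable M"
  shows "(\<lambda>x. control_kernel T (f x) (g x)) \<in> borel_measurable M"
  unfolding control_kernel_def by measurable

lemma control_kernel_nonneg: "control_kernel T s \<xi> \<ge> 0"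
  by (auto simp: control_kernel_def split: split_indicator)

lemma control_profile_measurable[measurable]:
  assumes [measurable]: "v \<in> borel_measurable borel"
  shows "control_profile T v \<in> borel_measurable borel"
proof -
  have "(\<lambda>s. LINT \<xi>|lborel. control_kernel T s \<xi> *\<^sub>R v \<xi>) \<in> borel_measurable borel"
    by (rule sigma_finite_measure.borel_measurable_lebesgue_integral[OF sigma_finite_lborel]) auto
  then show ?thesis
    unfolding control_profile_def[abs_def] by measurable
qed

lemma control_profile_nonpos: "s \<le> 0 \<Longrightarrow> control_profile T v s = 0"
  by (simp add: control_profile_def control_kernel_def)

text \<open>The origin is excluded because the kernel is cut off to zero at
  \<open>s = 0\<close>.\<close>

lemma control_state_eq_profile:
  assumes "x \<noteq> 0"
  shows "control_state u T x = control_profile T (\<lambda>\<xi>. indicator {0<..<T} \<xi> *\<^sub>R u (T - \<xi>)) ((norm x)\<^sup>2)"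
proof -
  have "(LINT \<xi>:{0<..<T}|lborel.
        complex_of_real (1 / (2 * \<xi>) * exp (- (norm x)\<^sup>2 / (4 * \<xi>))) * u (T - \<xi>)) =
      (LINT \<xi>|lborel. control_kernel T ((norm x)\<^sup>2) \<xi> *\<^sub>R (indicator {0<..<T} \<xi> *\<^sub>R u (T - \<xi>)))"
    unfolding set_lebesgue_integral_def using assms
    by (intro Bochner_Integration.integral_cong refl)
       (auto simp: control_kernel_def scaleR_conv_of_real split: split_indicator)
  then show ?thesis
    by (simp add: control_state_def control_profile_def)
qed

text \<open>A Gamma integral with rate \<open>1 / (4 * \<xi>)\<close> gives
  \<open>fact n * (4 * \<xi>) ^ Suc n\<close>, and the prefactor \<open>1 / (2 * \<xi>)\<close>
  leaves a multiple of \<open>\<xi> ^ n\<close>. This is how moments in \<open>s\<close> become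
  moments in \<open>\<xi>\<close>.\<close>

lemma control_kernel_moment:
  "has_bochner_integral lborel (\<lambda>s. s ^ n * control_kernel T s \<xi>)
    (2 * 4 ^ n * fact n * \<xi> ^ n * indicator {0<..<T} \<xi>)"
proof (cases "\<xi> \<in> {0<..<T}")
  case True
  have "has_bochner_integral lborel
      (\<lambda>s. 1 / (2 * \<xi>) * (s ^ n * exp (- (1 / (4 * \<xi>)) * s) * indicator {0<..} s))
      (1 / (2 * \<xi>) * (fact n / (1 / (4 * \<xi>)) ^ Suc n))"
    using True by (intro has_bochner_integral_mult_right has_bochner_integral_power_mult_exp_Ioi) auto
  moreover have "1 / (2 * \<xi>) * (s ^ n * exp (- (1 / (4 * \<xi>)) * s) * indicator {0<..} s) =
      s ^ n * control_kernel T s \<xi>" for s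
    using True by (simp add: control_kernel_def)
  moreover have "1 / (2 * \<xi>) * (fact n / (1 / (4 * \<xi>)) ^ Suc n) =
      2 * 4 ^ n * fact n * \<xi> ^ n * indicator {0<..<T} \<xi>"
    using True by (simp add: field_simps)
  ultimately show ?thesis by simp
qed (simp add: control_kernel_def has_bochner_integral_zero)

text \<open>The kernel decays at rate \<open>1 / (4 * \<xi>)\<close>, which exceeds
  \<open>1 / (4 * T)\<close>. The weight with rate \<open>1 / (8 * T)\<close> therefore uses up at
  most half of the decay, uniformly in \<open>\<xi>\<close>.\<close>

lemma integrable_control_kernel_weighted:
  assumes v[measurable]: "v \<in> borel_measurable borel"
    and bnd: "AE \<xi> in lborel. norm (v \<xi>) \<le> L" and T: "0 < T"
  shows "integrable (lborel \<Otimes>\<^sub>M lborel)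
    (\<lambda>(s, \<xi>). exp (1 / (8 * T) * s) *\<^sub>R (control_kernel T s \<xi> *\<^sub>R (v \<xi> :: complex)))"
proof (rule integrableI_bounded)
  interpret lborel_pair: pair_sigma_finite "lborel :: real measure" "lborel :: real measure" ..
  let ?e = "\<lambda>s. exp (1 / (8 * T) * s)"
  \<comment> \<open>The bound 4 is \<open>1 / (2 * \<xi>)\<close> times \<open>8 * \<xi>\<close>,
    the integral of the exponential with the remaining rate \<open>1 / (8 * \<xi>)\<close>. The
    singularity of the prefactor at \<open>\<xi> = 0\<close> cancels.\<close>
  have K: "(\<integral>\<^sup>+s. ennreal (?e s * control_kernel T s \<xi>) \<partial>lborel) \<le> 4 * indicator {0<..<T} \<xi>" for \<xi>
  proof (cases "\<xi> \<in> {0<..<T}")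
    case True
    have "?e s * control_kernel T s \<xi> \<le> 1 / (2 * \<xi>) * (s ^ 0 * exp (- (1 / (8 * \<xi>)) * s) * indicator {0<..} s)" for s
    proof (cases "0 < s")
      case s: True
      have "1 / (8 * T) * s \<le> 1 / (8 * \<xi>) * s"
        using True s by (intro mult_right_mono divide_left_mono) auto
      then have "1 / (8 * T) * s + (- s / (4 * \<xi>)) \<le> - (1 / (8 * \<xi>)) * s"
        by (simp add: field_simps)
      then have "?e s * exp (- s / (4 * \<xi>)) \<le> exp (- (1 / (8 * \<xi>)) * s)"
        unfolding exp_add[symmetric] by simp
      then have "1 / (2 * \<xi>) * (?e s * exp (- s / (4 * \<xi>))) \<le> 1 / (2 * \<xi>) * exp (- (1 / (8 * \<xi>)) * s)"
        using True by (intro mult_left_mono) auto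
      with s True show ?thesis
        by (simp add: control_kernel_def mult_ac)
    qed (simp add: control_kernel_def)
    then have "(\<integral>\<^sup>+s. ennreal (?e s * control_kernel T s \<xi>) \<partial>lborel) \<le>
        (\<integral>\<^sup>+s. ennreal (1 / (2 * \<xi>)) * ennreal (s ^ 0 * exp (- (1 / (8 * \<xi>)) * s) * indicator {0<..} s) \<partial>lborel)"
      using True by (intro nn_integral_mono) (auto simp flip: ennreal_mult)
    also have "\<dots> = ennreal (1 / (2 * \<xi>)) * ennreal (fact 0 / (1 / (8 * \<xi>)) ^ Suc 0)"
      using True by (subst nn_integral_cmult, simp, subst nn_integral_power_mult_exp_Ioi) auto
    also have "\<dots> = ennreal (1 / (2 * \<xi>) * (fact 0 / (1 / (8 * \<xi>)) ^ Suc 0))"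
      using True by (intro ennreal_mult[symmetric]) auto
    also have "1 / (2 * \<xi>) * (fact 0 / (1 / (8 * \<xi>)) ^ Suc 0) = 4"
      using True by simp
    finally show ?thesis using True by simp
  qed (simp add: control_kernel_def)
  have "(\<integral>\<^sup>+x. ennreal (norm (case x of (s, \<xi>) \<Rightarrow> ?e s *\<^sub>R (control_kernel T s \<xi> *\<^sub>R v \<xi>))) \<partial>(lborel \<Otimes>\<^sub>M lborel)) =
      (\<integral>\<^sup>+\<xi>. \<integral>\<^sup>+s. ennreal (norm (v \<xi>)) * ennreal (?e s * control_kernel T s \<xi>) \<partial>lborel \<partial>lborel)"
    by (subst lborel_pair.nn_integral_snd[symmetric])
       (auto intro!: nn_integral_cong simp: control_kernel_nonneg mult_ac simp flip: ennreal_mult)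
  also have "\<dots> = (\<integral>\<^sup>+\<xi>. ennreal (norm (v \<xi>)) * (\<integral>\<^sup>+s. ennreal (?e s * control_kernel T s \<xi>) \<partial>lborel) \<partial>lborel)"
    by (intro nn_integral_cong nn_integral_cmult) auto
  also have "\<dots> \<le> (\<integral>\<^sup>+\<xi>. ennreal L * 4 * indicator {0<..<T} \<xi> \<partial>lborel)"
    using bnd
  proof (intro nn_integral_mono_AE, eventually_elim)
    case (elim \<xi>)
    show ?case
      unfolding mult.assoc using elim by (intro mult_mono K ennreal_leI) auto
  qed
  also have "\<dots> < \<infinity>"
    using T by (subst nn_integral_cmult_indicator) (auto simp: ennreal_mult_less_top)
  finally show "(\<integral>\<^sup>+x. ennreal (norm (case x of (s, \<xi>) \<Rightarrow> ?e s *\<^sub>R (control_kernel T s \<xi> *\<^sub>R v \<xi>))) \<partial>(lborel \<Otimes>\<^sub>M lborel)) < \<infinity>" .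
qed auto

lemma integrable_control_profile_weighted:
  assumes "v \<in> borel_measurable borel" "AE \<xi> in lborel. norm (v \<xi>) \<le> L" "0 < T"
  shows "integrable lborel (\<lambda>s. exp (1 / (8 * T) * s) *\<^sub>R control_profile T v s)"
proof -
  interpret lborel_pair: pair_sigma_finite "lborel :: real measure" "lborel :: real measure" ..
  have "integrable lborel (\<lambda>s. LINT \<xi>|lborel. exp (1 / (8 * T) * s) *\<^sub>R (control_kernel T s \<xi> *\<^sub>R v \<xi>))"
    using lborel_pair.integrable_fst'[OF integrable_control_kernel_weighted[OF assms]]
    by (simp only: prod.case)
  then have "integrable lborel (\<lambda>s. - complex_of_real (1 / pi) *
      (exp (1 / (8 * T) * s) *\<^sub>R (LINT \<xi>|lborel. control_kernel T s \<xi> *\<^sub>R v \<xi>)))"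
    by (intro integrable_mult_right) (simp only: integral_scaleR_right)
  then show ?thesis
    by (simp add: control_profile_def)
qed

text \<open>Fubini's theorem moves the integration over \<open>s\<close> inside, where it is a
  moment of the kernel. Joint integrability follows from the exponentially weighted case, the weight
  dominating \<open>s ^ n\<close> up to the constant \<open>C\<close>.\<close>

lemma control_profile_moment:
  assumes v[measurable]: "v \<in> borel_measurable borel"
    and bnd: "AE \<xi> in lborel. norm (v \<xi>) \<le> L" and T: "0 < T"
    and supp: "\<And>\<xi>. \<xi> \<notin> {0<..<T} \<Longrightarrow> v \<xi> = 0"
  shows "(LINT s|lborel. s ^ n *\<^sub>R control_profile T v s) =
    - complex_of_real (2 * 4 ^ n * fact n / pi) * (LINT \<xi>|lborel. \<xi> ^ n *\<^sub>R v \<xi>)"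
proof -
  interpret lborel_pair: pair_sigma_finite "lborel :: real measure" "lborel :: real measure" ..
  let ?f = "\<lambda>s \<xi>. s ^ n *\<^sub>R (control_kernel T s \<xi> *\<^sub>R v \<xi>)"
  define C where "C = fact n / (1 / (8 * T)) ^ n"
  have C: "C \<ge> 0" using T by (simp add: C_def)
  have int: "integrable (lborel \<Otimes>\<^sub>M lborel) (\<lambda>(s, \<xi>). ?f s \<xi>)"
  proof (rule Bochner_Integration.integrable_bound)
    show "integrable (lborel \<Otimes>\<^sub>M lborel)
       (\<lambda>x. C *\<^sub>R (case x of (s, \<xi>) \<Rightarrow> exp (1 / (8 * T) * s) *\<^sub>R (control_kernel T s \<xi> *\<^sub>R v \<xi>)))"
      by (intro integrable_scaleR_right integrable_control_kernel_weighted[OF v bnd T])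
    have "norm (?f s \<xi>) \<le> norm (C *\<^sub>R (exp (1 / (8 * T) * s) *\<^sub>R (control_kernel T s \<xi> *\<^sub>R v \<xi>)))" for s \<xi>
    proof (cases "0 < s")
      case True
      then have "s ^ n \<le> C * exp (1 / (8 * T) * s)"
        unfolding C_def using T by (intro power_le_fact_mult_exp) auto
      then have "s ^ n * norm (control_kernel T s \<xi> *\<^sub>R v \<xi>) \<le>
          C * exp (1 / (8 * T) * s) * norm (control_kernel T s \<xi> *\<^sub>R v \<xi>)"
        by (rule mult_right_mono) simp
      with True C show ?thesis
        by (simp add: abs_mult mult_ac)
    qed (simp add: control_kernel_def)
    then show "AE x in lborel \<Otimes>\<^sub>M lborel. norm (case x of (s, \<xi>) \<Rightarrow> ?f s \<xi>) \<le>
        norm (C *\<^sub>R (case x of (s, \<xi>) \<Rightarrow> exp (1 / (8 * T) * s) *\<^sub>R (control_kernel T s \<xi> *\<^sub>R v \<xi>)))"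
      by (intro AE_I2) (simp only: split_beta)
  qed auto
  have "(LINT s|lborel. s ^ n *\<^sub>R control_profile T v s) =
      - complex_of_real (1 / pi) * (LINT s|lborel. LINT \<xi>|lborel. ?f s \<xi>)"
    by (simp only: control_profile_def integral_scaleR_right integral_mult_right_zero
        mult_scaleR_right[symmetric])
  also have "(LINT s|lborel. LINT \<xi>|lborel. ?f s \<xi>) = (LINT \<xi>|lborel. LINT s|lborel. ?f s \<xi>)"
    by (rule lborel_pair.Fubini_integral[OF int, symmetric])
  also have "\<dots> = (LINT \<xi>|lborel. (2 * 4 ^ n * fact n) *\<^sub>R (\<xi> ^ n *\<^sub>R v \<xi>))"
  proof (intro Bochner_Integration.integral_cong refl)
    fix \<xi>
    have "(LINT s|lborel. ?f s \<xi>) = (LINT s|lborel. s ^ n * control_kernel T s \<xi>) *\<^sub>R v \<xi>"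
      using control_kernel_moment[of n T \<xi>]
      by (subst integral_scaleR_left[symmetric]) (auto simp: has_bochner_integral_iff)
    also have "\<dots> = (2 * 4 ^ n * fact n) *\<^sub>R (\<xi> ^ n *\<^sub>R v \<xi>)"
      using control_kernel_moment[of n T \<xi>] supp[of \<xi>]
      by (cases "\<xi> \<in> {0<..<T}") (auto simp: has_bochner_integral_iff)
    finally show "(LINT s|lborel. ?f s \<xi>) = (2 * 4 ^ n * fact n) *\<^sub>R (\<xi> ^ n *\<^sub>R v \<xi>)" .
  qed
  also have "\<dots> = complex_of_real (2 * 4 ^ n * fact n) * (LINT \<xi>|lborel. \<xi> ^ n *\<^sub>R v \<xi>)"
    by (simp add: scaleR_conv_of_real)
  finally show ?thesis
    by simp
qed

section \<open>The reflected control and the decay of the target profile\<close>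

lemma AE_lborel_reflect:
  assumes "AE x in lborel. P (x :: real)"
  shows "AE x in lborel. P (c - x)"
proof -
  have "AE x in lborel. P (c + x)"
  proof (rule AE_distrD[of "(+) c" lborel borel P])
    show "AE x in distr lborel borel ((+) c). P x"
      using assms by (simp only: lborel_distr_plus)
  qed simp
  from AE_lborel_uminus[OF this] show ?thesis
    by simp
qed

lemma Linf_reflected:
  assumes "u \<in> Linf (lborel_on {0<..<T})" "Linf_norm (lborel_on {0<..<T}) u \<le> ereal L"
    and "0 \<le> L"
  defines "v \<equiv> \<lambda>\<xi>. indicator {0<..<T} \<xi> *\<^sub>R u (T - \<xi>)"
  shows "v \<in> borel_measurable borel" "AE \<xi> in lborel. cmod (v \<xi>) \<le> L"
proof -
  have "u \<in> borel_measurable (lborel_on {0<..<T})"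
    using assms by (simp add: Linf_def)
  then have [measurable]: "(\<lambda>t. indicator {0<..<T} t *\<^sub>R u t) \<in> borel_measurable borel"
    by (subst (asm) borel_measurable_restrict_space_iff) auto
  \<comment> \<open>The reflection maps the interval to itself, so \<open>v\<close> is the zero
    extension of \<open>u\<close> composed with it; this yields measurability on the whole
    line.\<close>
  have "v \<xi> = indicator {0<..<T} (T - \<xi>) *\<^sub>R u (T - \<xi>)" for \<xi>
    by (auto simp: v_def split: split_indicator)
  then show "v \<in> borel_measurable borel"
    using measurable_compose[of "\<lambda>\<xi>. T - \<xi>" borel borel "\<lambda>t. indicator {0<..<T} t *\<^sub>R u t" borel]
    by (simp add: measurable_cong[of borel v])
  have "AE t in lborel_on {0<..<T}. cmod (u t) \<le> L"
    using esssup_AE[of "\<lambda>t. ereal (cmod (u t))" "lborel_on {0<..<T}"]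
  proof eventually_elim
    case (elim t)
    also have "esssup (lborel_on {0<..<T}) (\<lambda>t. ereal (cmod (u t))) \<le> ereal L"
      using assms(2) by (simp add: Linf_norm_def)
    finally show ?case by simp
  qed
  then have "AE t in lborel. t \<in> {0<..<T} \<longrightarrow> cmod (u t) \<le> L"
    by (subst (asm) AE_restrict_space_iff) auto
  from AE_lborel_reflect[OF this, of T] show "AE \<xi> in lborel. cmod (v \<xi>) \<le> L"
    by eventually_elim (use \<open>0 \<le> L\<close> in \<open>auto simp: v_def split: split_indicator\<close>)
qed

text \<open>On \<open>0 < s < 1\<close> square integrability suffices, since the weight is bounded
  there. For \<open>s \<ge> 1\<close> the logarithm is at most \<open>4 * T\<close>, and the decay
  \<open>exp (- s / (4 * T))\<close> beats the weight.\<close>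

lemma integrable_weighted_radial_profile:
  fixes F :: "real \<Rightarrow> complex"
  assumes [measurable]: "F \<in> borel_measurable borel" and supp: "\<And>s. s \<le> 0 \<Longrightarrow> F s = 0"
    and sq: "integrable lborel (\<lambda>s. (cmod (F s))\<^sup>2)" and T: "0 < T" and C: "0 \<le> C"
    and bnd: "AE s in lborel. 0 < s \<longrightarrow> cmod (F s) \<le> C * exp (- s / (4 * T)) * ln (1 + 4 * T / s)"
  shows "integrable lborel (\<lambda>s. exp (1 / (8 * T) * s) *\<^sub>R F s)"
proof (rule Bochner_Integration.integrable_bound)
  let ?E = "exp (1 / (8 * T))"
  let ?w = "\<lambda>s. ?E * (indicator {0<..<1} s + (cmod (F s))\<^sup>2) +
    (C * (4 * T)) * (s ^ 0 * exp (- (1 / (8 * T)) * s) * indicator {0<..} s)"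
  show "integrable lborel ?w"
    using has_bochner_integral_power_mult_exp_Ioi[of "1 / (8 * T)" 0] T
    by (intro Bochner_Integration.integrable_add integrable_mult_right sq)
       (auto simp: has_bochner_integral_iff)
  show "AE s in lborel. norm (exp (1 / (8 * T) * s) *\<^sub>R F s) \<le> norm (?w s)"
    using bnd
  proof eventually_elim
    case (elim s)
    have w: "0 \<le> ?w s"
      using C T by (auto intro!: add_nonneg_nonneg mult_nonneg_nonneg split: split_indicator)
    have tail: "0 \<le> (C * (4 * T)) * (s ^ 0 * exp (- (1 / (8 * T)) * s) * indicator {0<..} s)"
      using C T by (auto split: split_indicator)
    have "exp (1 / (8 * T) * s) * cmod (F s) \<le> ?w s"
    proof -
      consider "s \<le> 0" | "0 < s" "s < 1" | "1 \<le> s" by linarith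
      then show ?thesis
      proof cases
        case 1
        then show ?thesis using w by (simp add: supp)
      next
        case 2
        have "exp (1 / (8 * T) * s) \<le> ?E"
          using 2 T by (simp add: divide_right_mono)
        \<comment> \<open>Expanding the square of \<open>cmod (F s) - 1 / 2\<close> gives this even
          with 1/4 in place of 1.\<close>
        moreover have "cmod (F s) \<le> 1 + (cmod (F s))\<^sup>2"
          using zero_le_power2[of "cmod (F s) - 1 / 2"] by (simp add: power2_eq_square algebra_simps)
        ultimately have "exp (1 / (8 * T) * s) * cmod (F s) \<le> ?E * (1 + (cmod (F s))\<^sup>2)"
          by (intro mult_mono) auto
        with 2 tail show ?thesis by simp
      next
        case 3
        have "ln (1 + 4 * T / s) \<le> 4 * T / s"
          using 3 T by (intro ln_add_one_self_le_self) auto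
        also have "\<dots> \<le> 4 * T"
          using 3 T by (simp add: field_simps)
        finally have "C * exp (- s / (4 * T)) * ln (1 + 4 * T / s) \<le> C * exp (- s / (4 * T)) * (4 * T)"
          using C by (intro mult_left_mono) auto
        with elim 3 have "exp (1 / (8 * T) * s) * cmod (F s) \<le>
            exp (1 / (8 * T) * s) * (C * exp (- s / (4 * T)) * (4 * T))"
          by (intro mult_left_mono) auto
        also have "\<dots> = C * (4 * T) * (exp (1 / (8 * T) * s) * exp (- s / (4 * T)))"
          by simp
        also have "exp (1 / (8 * T) * s) * exp (- s / (4 * T)) = exp (- (1 / (8 * T)) * s)"
          using T unfolding exp_add[symmetric] by (simp add: field_simps)
        also have "C * (4 * T) * exp (- (1 / (8 * T)) * s) \<le> ?w s"
          using 3 by simp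
        finally show ?thesis .
      qed
    qed
    then show ?case
      using w by simp
  qed
qed auto

text \<open>The three constants come from the normalization of \<open>\<omega>\<close>, from the
  passage to the quadrant and from the kernel moments. Their product is 1, so
  \<open>\<omega> n\<close> is the moment of the control itself.\<close>

lemma moment_constants:
  "- 2 * (fact n / fact (2 * n)) * (complex_of_real (radial_const n) * (- complex_of_real (2 * 4 ^ n * fact n / pi) * z)) = z"
proof -
  have "- 2 * (fact n / fact (2 * n)) * (radial_const n * (- (2 * 4 ^ n * fact n / pi))) = (1 :: real)"
    by (simp add: radial_const_def field_simps power2_eq_square)
  then have "complex_of_real (- 2 * (fact n / fact (2 * n)) * (radial_const n * (- (2 * 4 ^ n * fact n / pi)))) = 1"
    by (simp only: of_real_1)
  then show ?thesis
    by (simp add: mult_ac)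
qed

subsection \<open>The reachability criterion\<close>

theorem theorem3p9:
  fixes L T :: real and W0 WT W0T :: "real \<times> real \<Rightarrow> complex" and \<omega> :: "nat \<Rightarrow> complex"
  assumes "L > 0" and "T > 0"
    and "W0 \<in> H0_hat" and "WT \<in> H0_hat"
    and W0T_def: "W0T = (\<lambda>x. WT x - free_state W0 T x)"
    and "W0T \<in> H_rad"
    and "AE x in lborel. x \<noteq> 0 \<longrightarrow>
      cmod (W0T x) \<le> L / (2 * pi) * exp (- (norm x)\<^sup>2 / (4 * T)) * ln (1 + 4 * T / (norm x)\<^sup>2)"
    and \<omega>_def: "\<And>n. \<omega> n = - 2 * (fact n / fact (2 * n)) *
      (LINT x2:{0<..}|lborel. (LINT x1:{0<..}|lborel. complex_of_real (x1 ^ (2 * n)) * W0T (x1, x2)))"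
  shows "WT \<in> reachable T L W0 \<longleftrightarrow>
    (\<exists>u \<in> Linf (lborel_on {0<..<T}). Linf_norm (lborel_on {0<..<T}) u \<le> ereal L \<and>
      (\<forall>n. (LINT \<xi>:{0<..<T}|lborel. complex_of_real (\<xi> ^ n) * u (T - \<xi>)) = \<omega> n))"
proof -
  have W0T[measurable]: "W0T \<in> borel_measurable borel"
    using \<open>W0T \<in> H_rad\<close> by (simp add: H_rad_def L2_def)
  have nz: "AE x in lborel. x \<noteq> (0 :: real \<times> real)"
    by (rule AE_lborel_singleton)
  obtain g where g: "g \<in> L2 (lborel_on {0<..})" and W0T_g: "AE x in lborel. W0T x = g ((norm x)\<^sup>2)"
    using \<open>W0T \<in> H_rad\<close> by (auto simp: H_rad_def)
  \<comment> \<open>The zero extension of \<open>g\<close> is defined on the whole line, as the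
    moment lemmas require, and gives the same radial function off the origin.\<close>
  define F where "F s = indicator {0<..} s *\<^sub>R g s" for s :: real
  have F[measurable]: "F \<in> borel_measurable borel"
    using g unfolding F_def[abs_def] L2_def
    by (auto simp: borel_measurable_restrict_space_iff)
  have F_supp: "s \<le> 0 \<Longrightarrow> F s = 0" for s
    by (simp add: F_def)
  have "integrable lborel (\<lambda>s. indicator {0<..} s *\<^sub>R (cmod (g s))\<^sup>2)"
    using g by (simp add: L2_def integrable_restrict_space)
  then have F_sq: "integrable lborel (\<lambda>s. (cmod (F s))\<^sup>2)"
    by (rule Bochner_Integration.integrable_cong[THEN iffD1, rotated -1]) (auto simp: F_def split: split_indicator)
  have W0T_F: "AE x in lborel. W0T x = F ((norm x)\<^sup>2)"
    using W0T_g nz by eventually_elim (simp add: F_def)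
  have "AE x in lborel. 0 < (norm (x :: real \<times> real))\<^sup>2 \<longrightarrow> cmod (F ((norm x)\<^sup>2)) \<le>
      L / (2 * pi) * exp (- (norm x)\<^sup>2 / (4 * T)) * ln (1 + 4 * T / (norm x)\<^sup>2)"
    using assms(7) W0T_F by eventually_elim auto
  then have F_bound: "AE s in lborel. 0 < s \<longrightarrow>
      cmod (F s) \<le> L / (2 * pi) * exp (- s / (4 * T)) * ln (1 + 4 * T / s)"
    by (subst (asm) AE_radial_iff) auto
  have F_int: "integrable lborel (\<lambda>s. exp (1 / (8 * T) * s) *\<^sub>R F s)"
    using \<open>L > 0\<close> \<open>T > 0\<close> by (intro integrable_weighted_radial_profile[OF F F_supp F_sq _ _ F_bound]) auto
  have \<epsilon>: "0 < 1 / (8 * T)"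
    using \<open>T > 0\<close> by simp
  have F_mom: "integrable lborel (\<lambda>s. s ^ n *\<^sub>R F s)" for n
    using integrable_power_mult_exp_weighted[OF F F_supp F_int \<epsilon>, of n] by simp
  \<comment> \<open>The equivalence is shown for each admissible \<open>u\<close> separately, so the
    same control serves in both directions.\<close>
  have "(AE x in lborel. WT x = free_state W0 T x + control_state u T x) \<longleftrightarrow>
      (\<forall>n. (LINT \<xi>:{0<..<T}|lborel. complex_of_real (\<xi> ^ n) * u (T - \<xi>)) = \<omega> n)"
    if u: "u \<in> Linf (lborel_on {0<..<T})" "Linf_norm (lborel_on {0<..<T}) u \<le> ereal L" for u
  proof -
    define v where "v \<xi> = indicator {0<..<T} \<xi> *\<^sub>R u (T - \<xi>)" for \<xi>
    have v[measurable]: "v \<in> borel_measurable borel" and v_bound: "AE \<xi> in lborel. norm (v \<xi>) \<le> L"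
      using Linf_reflected[OF u] \<open>L > 0\<close> by (auto simp: v_def[abs_def])
    have v_supp: "\<xi> \<notin> {0<..<T} \<Longrightarrow> v \<xi> = 0" for \<xi>
      by (simp add: v_def)
    have v_mom: "(LINT \<xi>:{0<..<T}|lborel. complex_of_real (\<xi> ^ n) * u (T - \<xi>)) = (LINT \<xi>|lborel. \<xi> ^ n *\<^sub>R v \<xi>)" for n
      unfolding set_lebesgue_integral_def
      by (intro Bochner_Integration.integral_cong refl) (simp add: v_def scaleR_conv_of_real mult_ac)
    let ?G = "control_profile T v"
    have G_int: "integrable lborel (\<lambda>s. exp (1 / (8 * T) * s) *\<^sub>R ?G s)"
      by (rule integrable_control_profile_weighted[OF v v_bound \<open>T > 0\<close>])
    have G_mom: "integrable lborel (\<lambda>s. s ^ n *\<^sub>R ?G s)" for n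
      using integrable_power_mult_exp_weighted[OF _ control_profile_nonpos G_int \<epsilon>, of n] by simp
    \<comment> \<open>The numbers \<open>\<omega> n\<close> and the moments of \<open>v\<close> are
      brought to the same form, the first with the profile \<open>F\<close> of \<open>W0T\<close>,
      the second with the profile of the controlled state.\<close>
    have \<omega>_F: "\<omega> n = - 2 * (fact n / fact (2 * n)) *
        (complex_of_real (radial_const n) * (LINT s|lborel. s ^ n *\<^sub>R F s))" for n
      unfolding \<omega>_def by (subst quadrant_moment_radial[OF W0T F F_supp F_mom W0T_F]) auto
    have \<omega>_G: "(LINT \<xi>|lborel. \<xi> ^ n *\<^sub>R v \<xi>) = - 2 * (fact n / fact (2 * n)) *
        (complex_of_real (radial_const n) * (LINT s|lborel. s ^ n *\<^sub>R ?G s))" for n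
      using v_supp by (subst control_profile_moment[OF v v_bound \<open>T > 0\<close>]) (simp_all only: moment_constants)
    have "(AE x in lborel. WT x = free_state W0 T x + control_state u T x) \<longleftrightarrow>
        (AE x in lborel. F ((norm (x :: real \<times> real))\<^sup>2) = ?G ((norm x)\<^sup>2))"
    proof (rule eventually_cong[OF AE_conjI[OF nz W0T_F]])
      fix x :: "real \<times> real" assume x: "x \<noteq> 0 \<and> W0T x = F ((norm x)\<^sup>2)"
      then have "control_state u T x = ?G ((norm x)\<^sup>2)"
        by (simp add: control_state_eq_profile v_def[abs_def])
      then show "WT x = free_state W0 T x + control_state u T x \<longleftrightarrow> F ((norm x)\<^sup>2) = ?G ((norm x)\<^sup>2)"
        using x by (auto simp: W0T_def algebra_simps)
    qed
    also have "\<dots> \<longleftrightarrow> (AE s in lborel. F s = ?G s)"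
      by (subst AE_radial_iff) (auto intro!: AE_cong simp: F_supp control_profile_nonpos not_less)
    also have "\<dots> \<longleftrightarrow> (\<forall>n. (LINT s|lborel. s ^ n *\<^sub>R F s) = (LINT s|lborel. s ^ n *\<^sub>R ?G s))"
    proof (intro iffI allI)
      fix n assume "AE s in lborel. F s = ?G s"
      then show "(LINT s|lborel. s ^ n *\<^sub>R F s) = (LINT s|lborel. s ^ n *\<^sub>R ?G s)"
        by (intro integral_cong_AE) auto
    next
      assume eq: "\<forall>n. (LINT s|lborel. s ^ n *\<^sub>R F s) = (LINT s|lborel. s ^ n *\<^sub>R ?G s)"
      \<comment> \<open>Both profiles are integrable against the same weight with rate
        \<open>1 / (8 * T)\<close>, so determinacy applies to their difference.\<close>
      have "AE s in lborel. F s - ?G s = 0"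
      proof (rule AE_zero_of_vanishing_moments[OF _ _ _ \<epsilon>])
        show "integrable lborel (\<lambda>s. exp (1 / (8 * T) * s) *\<^sub>R (F s - ?G s))"
          unfolding scaleR_diff_right by (intro Bochner_Integration.integrable_diff F_int G_int)
        show "(LINT s|lborel. s ^ n *\<^sub>R (F s - ?G s)) = 0" for n
          unfolding scaleR_diff_right using eq
          by (subst Bochner_Integration.integral_diff[OF F_mom G_mom]) simp
      qed (auto simp: F_supp control_profile_nonpos)
      then show "AE s in lborel. F s = ?G s"
        by simp
    qed
    \<comment> \<open>The common factors are nonzero and cancel.\<close>
    also have "\<dots> \<longleftrightarrow> (\<forall>n. (LINT \<xi>|lborel. \<xi> ^ n *\<^sub>R v \<xi>) = \<omega> n)"
      using radial_const_pos by (auto simp: \<omega>_F \<omega>_G less_le)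
    finally show ?thesis
      unfolding v_mom .
  qed
  then show ?thesis
    using \<open>WT \<in> H0_hat\<close> unfolding reachable_def by blast
qed

end
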